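(* Let $(M,J,g)$ be an almost Norden manifold with associated metric $\widetilde g(X,Y)=g(X,JY)$, and let $\nabla$ and $\nabla^\ast$ be linear connections on $M$. Then: (i) if $(M,J,g,\nabla,\nabla^\ast)$ is a statistical manifold and $\nabla^\ast$ is the conjugate connection of $\nabla$ relative to $J$, then $(M,J,g)$ is a Kähler (Norden) manifold; (ii) if $(M,J,\widetilde g,\nabla,\nabla^\ast)$ is a statistical manifold and $\nabla^\ast$ is the conjugate connection of $\nabla$ relative to $J$, then $(M,J,g)$ is a Kähler (Norden) manifold.
   Context: An almost Norden manifold $(M,J,g)$ is a differentiable $2n$-dimensional manifold $M$ with an almost complex structure $J$ ($J^2=-\mathrm{id}$) and a pseudo-Riemannian metric $g$ such that $g(JX,JY)=-g(X,Y)$. Then $\widetilde g(X,Y)=g(X,JY)$ is also a (symmetric, nondegenerate) pseudo-Riemannian metric. $(M,J,g)$ is a Kähler (Norden) manifold if $\nabla^0J=0$, where $\nabla^0$ is the Levi-Civita connection of $g$. For a pseudo-Riemannian metric $h$ ($h=g$ or $h=\widetilde g$), $(M,J,h,\nabla,\nabla^\ast)$ is a statistical manifold if $\nabla$ and $\nabla^\ast$ are both torsion free and are conjugate relative to $h$, i.e. $X h(Y,Z)=h(\nabla_XY,Z)+h(Y,\nabla^\ast_XZ)$. The conjugate connection of $\nabla$ relative to $J$ is $\nabla^\ast_XY=-J\nabla_X(JY)=\nabla_XY-J(\nabla_XJ)Y$. *)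

theory Defs
  imports "HOL-Analysis.Analysis" "HOL-Library.Function_Algebras"
begin

(* HOL-Library.Function_Algebras supplies the pointwise 0, +, -, * on functions.  They are used for
   smooth functions, for tangent vectors (functionals on smooth functions) and for vector fields. *)

section \<open>Smooth maps between Euclidean spaces\<close>

(* Only meant for open S: derivatives are taken "at x", not "at x within S".
   Since v ranges over the finite-dimensional 'e, continuity and differentiability of all iterated
   directional derivatives is the usual notion of C^k. *)
primrec Ck_on :: "nat \<Rightarrow> 'e::euclidean_space set \<Rightarrow> ('e \<Rightarrow> 'f::real_normed_vector) \<Rightarrow> bool" where
  "Ck_on 0 S f \<longleftrightarrow> continuous_on S f"
| "Ck_on (Suc k) S f \<longleftrightarrow>
     (\<forall>x\<in>S. f differentiable (at x)) \<and> (\<forall>v. Ck_on k S (\<lambda>x. frechet_derivative f (at x) v))"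

definition Cinf_on :: "'e::euclidean_space set \<Rightarrow> ('e \<Rightarrow> 'f::real_normed_vector) \<Rightarrow> bool" where
  "Cinf_on S f \<longleftrightarrow> (\<forall>k. Ck_on k S f)"

section \<open>Smooth manifolds, tangent vectors, vector fields\<close>

(* The underlying topological space is the whole type 'a (Hausdorff and second countable, by its
   sort in the definitions below); the manifold is modelled on 'e, so its dimension is DIM('e).
   A chart (U, \<phi>) is only relevant on its domain U.  The atlas need not be maximal. *)
type_synonym ('a, 'e) atlas = "('a set \<times> ('a \<Rightarrow> 'e)) set"

definition smooth_manifold ::
  "('a::{t2_space,second_countable_topology}, 'e::euclidean_space) atlas \<Rightarrow> bool" where
  "smooth_manifold A \<longleftrightarrow>
     (\<forall>(U, \<phi>)\<in>A. open U \<and> open (\<phi> ` U) \<and> homeomorphism U (\<phi> ` U) \<phi> (inv_into U \<phi>)) \<and>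
     (\<Union>(U, \<phi>)\<in>A. U) = UNIV \<and>
     (\<forall>(U, \<phi>)\<in>A. \<forall>(V, \<psi>)\<in>A. Cinf_on (\<phi> ` (U \<inter> V)) (\<psi> \<circ> inv_into U \<phi>))"

definition smooth_fun ::
  "('a::{t2_space,second_countable_topology}, 'e::euclidean_space) atlas \<Rightarrow> ('a \<Rightarrow> real) set" where
  "smooth_fun A = {f. \<forall>(U, \<phi>)\<in>A. Cinf_on (\<phi> ` U) (f \<circ> inv_into U \<phi>)}"

type_synonym 'a tvec = "('a \<Rightarrow> real) \<Rightarrow> real"
type_synonym 'a vfield = "'a \<Rightarrow> 'a tvec"

definition scl :: "real \<Rightarrow> 'a tvec \<Rightarrow> 'a tvec" where
  "scl c v = (\<lambda>f. c * v f)"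

(* Tangent vectors at p are derivations at p of the algebra of smooth functions; the last clause
   fixes the irrelevant values off that algebra, so that equality of tangent vectors is HOL
   equality. *)
definition tangent_space ::
  "('a::{t2_space,second_countable_topology}, 'e::euclidean_space) atlas \<Rightarrow> 'a \<Rightarrow> 'a tvec set" where
  "tangent_space A p = {v.
     (\<forall>f\<in>smooth_fun A. \<forall>h\<in>smooth_fun A. v (f + h) = v f + v h) \<and>
     (\<forall>c. \<forall>f\<in>smooth_fun A. v (\<lambda>x. c * f x) = c * v f) \<and>
     (\<forall>f\<in>smooth_fun A. \<forall>h\<in>smooth_fun A. v (f * h) = f p * v h + h p * v f) \<and>
     (\<forall>f. f \<notin> smooth_fun A \<longrightarrow> v f = 0)}"

definition vector_fields ::
  "('a::{t2_space,second_countable_topology}, 'e::euclidean_space) atlas \<Rightarrow> 'a vfield set" where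
  "vector_fields A = {X. (\<forall>p. X p \<in> tangent_space A p) \<and>
     (\<forall>f\<in>smooth_fun A. (\<lambda>p. X p f) \<in> smooth_fun A)}"

definition fmul :: "('a \<Rightarrow> real) \<Rightarrow> 'a vfield \<Rightarrow> 'a vfield" where
  "fmul f X = (\<lambda>p. scl (f p) (X p))"

definition lie_bracket :: "'a vfield \<Rightarrow> 'a vfield \<Rightarrow> 'a vfield" where
  "lie_bracket X Y = (\<lambda>p f. X p (\<lambda>q. Y q f) - Y p (\<lambda>q. X q f))"

section \<open>Tensor fields of type (1,1) and (0,2), almost complex structures, metrics\<close>

type_synonym 'a endo = "'a \<Rightarrow> 'a tvec \<Rightarrow> 'a tvec"
type_synonym 'a form2 = "'a \<Rightarrow> 'a tvec \<Rightarrow> 'a tvec \<Rightarrow> real"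

definition app :: "'a endo \<Rightarrow> 'a vfield \<Rightarrow> 'a vfield" where
  "app J X = (\<lambda>p. J p (X p))"

definition eval2 :: "'a form2 \<Rightarrow> 'a vfield \<Rightarrow> 'a vfield \<Rightarrow> 'a \<Rightarrow> real" where
  "eval2 h X Y = (\<lambda>p. h p (X p) (Y p))"

(* A pointwise (multi)linear field is smooth iff it maps smooth vector fields to smooth objects. *)
definition smooth_endo ::
  "('a::{t2_space,second_countable_topology}, 'e::euclidean_space) atlas \<Rightarrow> 'a endo \<Rightarrow> bool" where
  "smooth_endo A J \<longleftrightarrow>
     (\<forall>p. \<forall>v\<in>tangent_space A p. J p v \<in> tangent_space A p) \<and>
     (\<forall>p. \<forall>v\<in>tangent_space A p. \<forall>w\<in>tangent_space A p. J p (v + w) = J p v + J p w) \<and>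
     (\<forall>p c. \<forall>v\<in>tangent_space A p. J p (scl c v) = scl c (J p v)) \<and>
     (\<forall>X\<in>vector_fields A. app J X \<in> vector_fields A)"

definition smooth_form2 ::
  "('a::{t2_space,second_countable_topology}, 'e::euclidean_space) atlas \<Rightarrow> 'a form2 \<Rightarrow> bool" where
  "smooth_form2 A h \<longleftrightarrow>
     (\<forall>p. \<forall>u\<in>tangent_space A p. \<forall>v\<in>tangent_space A p. \<forall>w\<in>tangent_space A p.
        h p (u + v) w = h p u w + h p v w \<and> h p w (u + v) = h p w u + h p w v) \<and>
     (\<forall>p c. \<forall>v\<in>tangent_space A p. \<forall>w\<in>tangent_space A p.
        h p (scl c v) w = c * h p v w \<and> h p v (scl c w) = c * h p v w) \<and>
     (\<forall>X\<in>vector_fields A. \<forall>Y\<in>vector_fields A. eval2 h X Y \<in> smooth_fun A)"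

(* The index is locally constant by nondegeneracy; on an almost Norden manifold it is constant,
   since J is an anti-isometry and the signature is therefore neutral. *)
definition pseudo_riemannian_metric ::
  "('a::{t2_space,second_countable_topology}, 'e::euclidean_space) atlas \<Rightarrow> 'a form2 \<Rightarrow> bool" where
  "pseudo_riemannian_metric A h \<longleftrightarrow> smooth_form2 A h \<and>
     (\<forall>p. \<forall>v\<in>tangent_space A p. \<forall>w\<in>tangent_space A p. h p v w = h p w v) \<and>
     (\<forall>p. \<forall>v\<in>tangent_space A p. (\<forall>w\<in>tangent_space A p. h p v w = 0) \<longrightarrow> v = 0)"

definition almost_complex_structure ::
  "('a::{t2_space,second_countable_topology}, 'e::euclidean_space) atlas \<Rightarrow> 'a endo \<Rightarrow> bool" where
  "almost_complex_structure A J \<longleftrightarrow> smooth_endo A J \<and>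
     (\<forall>p. \<forall>v\<in>tangent_space A p. J p (J p v) = - v)"

definition almost_norden_manifold ::
  "('a::{t2_space,second_countable_topology}, 'e::euclidean_space) atlas \<Rightarrow> 'a endo \<Rightarrow> 'a form2 \<Rightarrow> bool"
where
  "almost_norden_manifold A J g \<longleftrightarrow>
     smooth_manifold A \<and> (\<exists>n. DIM('e) = 2 * n) \<and>
     almost_complex_structure A J \<and> pseudo_riemannian_metric A g \<and>
     (\<forall>p. \<forall>v\<in>tangent_space A p. \<forall>w\<in>tangent_space A p. g p (J p v) (J p w) = - g p v w)"

definition associated_metric :: "'a endo \<Rightarrow> 'a form2 \<Rightarrow> 'a form2" where
  "associated_metric J g = (\<lambda>p v w. g p v (J p w))"

section \<open>Linear connections\<close>

(* Values of D off the smooth vector fields are irrelevant.  Homogeneity over the reals in the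
   second argument is the Leibniz rule for constant functions. *)
definition linear_connection ::
  "('a::{t2_space,second_countable_topology}, 'e::euclidean_space) atlas \<Rightarrow>
   ('a vfield \<Rightarrow> 'a vfield \<Rightarrow> 'a vfield) \<Rightarrow> bool" where
  "linear_connection A D \<longleftrightarrow>
     (\<forall>X\<in>vector_fields A. \<forall>Y\<in>vector_fields A. D X Y \<in> vector_fields A) \<and>
     (\<forall>X\<in>vector_fields A. \<forall>Y\<in>vector_fields A. \<forall>Z\<in>vector_fields A.
        D (X + Y) Z = D X Z + D Y Z \<and> D Z (X + Y) = D Z X + D Z Y) \<and>
     (\<forall>f\<in>smooth_fun A. \<forall>X\<in>vector_fields A. \<forall>Y\<in>vector_fields A.
        D (fmul f X) Y = fmul f (D X Y) \<and>
        D X (fmul f Y) = fmul (\<lambda>p. X p f) Y + fmul f (D X Y))"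

definition torsion ::
  "('a vfield \<Rightarrow> 'a vfield \<Rightarrow> 'a vfield) \<Rightarrow> 'a vfield \<Rightarrow> 'a vfield \<Rightarrow> 'a vfield" where
  "torsion D X Y = D X Y - D Y X - lie_bracket X Y"

definition torsion_free ::
  "('a::{t2_space,second_countable_topology}, 'e::euclidean_space) atlas \<Rightarrow>
   ('a vfield \<Rightarrow> 'a vfield \<Rightarrow> 'a vfield) \<Rightarrow> bool" where
  "torsion_free A D \<longleftrightarrow> (\<forall>X\<in>vector_fields A. \<forall>Y\<in>vector_fields A. torsion D X Y = 0)"

definition conjugate_rel_metric ::
  "('a::{t2_space,second_countable_topology}, 'e::euclidean_space) atlas \<Rightarrow> 'a form2 \<Rightarrow>
   ('a vfield \<Rightarrow> 'a vfield \<Rightarrow> 'a vfield) \<Rightarrow> ('a vfield \<Rightarrow> 'a vfield \<Rightarrow> 'a vfield) \<Rightarrow> bool" where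
  "conjugate_rel_metric A h D D' \<longleftrightarrow>
     (\<forall>X\<in>vector_fields A. \<forall>Y\<in>vector_fields A. \<forall>Z\<in>vector_fields A. \<forall>p.
        X p (eval2 h Y Z) = eval2 h (D X Y) Z p + eval2 h Y (D' X Z) p)"

definition conjugate_rel_endo ::
  "('a::{t2_space,second_countable_topology}, 'e::euclidean_space) atlas \<Rightarrow> 'a endo \<Rightarrow>
   ('a vfield \<Rightarrow> 'a vfield \<Rightarrow> 'a vfield) \<Rightarrow> ('a vfield \<Rightarrow> 'a vfield \<Rightarrow> 'a vfield) \<Rightarrow> bool" where
  "conjugate_rel_endo A J D D' \<longleftrightarrow>
     (\<forall>X\<in>vector_fields A. \<forall>Y\<in>vector_fields A. D' X Y = - app J (D X (app J Y)))"

definition statistical_manifold ::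
  "('a::{t2_space,second_countable_topology}, 'e::euclidean_space) atlas \<Rightarrow> 'a form2 \<Rightarrow>
   ('a vfield \<Rightarrow> 'a vfield \<Rightarrow> 'a vfield) \<Rightarrow> ('a vfield \<Rightarrow> 'a vfield \<Rightarrow> 'a vfield) \<Rightarrow> bool" where
  "statistical_manifold A h D D' \<longleftrightarrow>
     smooth_manifold A \<and> pseudo_riemannian_metric A h \<and>
     linear_connection A D \<and> linear_connection A D' \<and>
     torsion_free A D \<and> torsion_free A D' \<and> conjugate_rel_metric A h D D'"

definition levi_civita_connection ::
  "('a::{t2_space,second_countable_topology}, 'e::euclidean_space) atlas \<Rightarrow> 'a form2 \<Rightarrow>
   ('a vfield \<Rightarrow> 'a vfield \<Rightarrow> 'a vfield) \<Rightarrow> bool" where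
  "levi_civita_connection A h D \<longleftrightarrow>
     linear_connection A D \<and> torsion_free A D \<and>
     (\<forall>X\<in>vector_fields A. \<forall>Y\<in>vector_fields A. \<forall>Z\<in>vector_fields A. \<forall>p.
        X p (eval2 h Y Z) = eval2 h (D X Y) Z p + eval2 h Y (D X Z) p)"

definition cov_deriv_endo ::
  "('a vfield \<Rightarrow> 'a vfield \<Rightarrow> 'a vfield) \<Rightarrow> 'a endo \<Rightarrow> 'a vfield \<Rightarrow> 'a vfield \<Rightarrow> 'a vfield" where
  "cov_deriv_endo D J X Y = D X (app J Y) - app J (D X Y)"

(* "The" Levi-Civita connection is unique on smooth vector fields only (an HOL function D has
   arbitrary values elsewhere), so it is bound by an existential quantifier rather than THE. *)
definition kahler_norden_manifold ::
  "('a::{t2_space,second_countable_topology}, 'e::euclidean_space) atlas \<Rightarrow> 'a endo \<Rightarrow> 'a form2 \<Rightarrow> bool"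
where
  "kahler_norden_manifold A J g \<longleftrightarrow> almost_norden_manifold A J g \<and>
     (\<exists>D. levi_civita_connection A g D \<and>
       (\<forall>X\<in>vector_fields A. \<forall>Y\<in>vector_fields A. cov_deriv_endo D J X Y = 0))"

section \<open>Two remarks made in the definitions\<close>

lemma scl_minus_one: "scl (- 1) v = - v"
  by (simp add: scl_def fun_eq_iff)

lemma associated_metric_pseudo_riemannian:
  assumes "almost_norden_manifold A J g"
  shows "pseudo_riemannian_metric A (associated_metric J g)"
proof -
  have J: "smooth_endo A J" and JJ: "\<And>p v. v \<in> tangent_space A p \<Longrightarrow> J p (J p v) = - v"
    and g: "smooth_form2 A g"
    and sym: "\<And>p v w. v \<in> tangent_space A p \<Longrightarrow> w \<in> tangent_space A p \<Longrightarrow> g p v w = g p w v"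
    and nd: "\<And>p v. v \<in> tangent_space A p \<Longrightarrow> (\<forall>w\<in>tangent_space A p. g p v w = 0) \<Longrightarrow> v = 0"
    and anti: "\<And>p v w. v \<in> tangent_space A p \<Longrightarrow> w \<in> tangent_space A p \<Longrightarrow>
                 g p (J p v) (J p w) = - g p v w"
    using assms unfolding almost_norden_manifold_def almost_complex_structure_def
      pseudo_riemannian_metric_def by simp_all
  have JT: "\<And>p v. v \<in> tangent_space A p \<Longrightarrow> J p v \<in> tangent_space A p"
    and JX: "\<And>X. X \<in> vector_fields A \<Longrightarrow> app J X \<in> vector_fields A"
    and Jadd: "\<And>p v w. v \<in> tangent_space A p \<Longrightarrow> w \<in> tangent_space A p \<Longrightarrow>
                 J p (v + w) = J p v + J p w"
    and Jscl: "\<And>p c v. v \<in> tangent_space A p \<Longrightarrow> J p (scl c v) = scl c (J p v)"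
    using J unfolding smooth_endo_def by simp_all
  have gscl: "\<And>p c v w. v \<in> tangent_space A p \<Longrightarrow> w \<in> tangent_space A p \<Longrightarrow>
                g p v (scl c w) = c * g p v w"
    using g unfolding smooth_form2_def by simp
  have neg: "g p v (- w) = - g p v w" if "v \<in> tangent_space A p" "w \<in> tangent_space A p" for p v w
    using gscl[OF that, of "- 1"] by (simp add: scl_minus_one)
  have 1: "smooth_form2 A (associated_metric J g)"
  proof -
    have "eval2 (associated_metric J g) X Y = eval2 g X (app J Y)" for X Y
      by (simp add: eval2_def associated_metric_def app_def)
    then show ?thesis
      using g JX unfolding smooth_form2_def
      by (simp add: associated_metric_def JT Jadd Jscl)
  qed
  have 2: "g p v (J p w) = g p w (J p v)" if "v \<in> tangent_space A p" "w \<in> tangent_space A p" for p v w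
    using anti[OF that(1) JT[OF that(2)]] JJ[OF that(2)] neg[OF JT[OF that(1)] that(2)]
      sym[OF JT[OF that(1)] that(2)] by simp
  have 3: "v = 0"
    if v: "v \<in> tangent_space A p" and z: "\<forall>w\<in>tangent_space A p. g p v (J p w) = 0" for p v
  proof (rule nd[OF v], rule ballI)
    fix w assume w: "w \<in> tangent_space A p"
    have "g p v (J p (J p w)) = 0" using z JT[OF w] by blast
    then show "g p v w = 0" using JJ[OF w] neg[OF v w] by simp
  qed
  from 1 2 3 show ?thesis
    unfolding pseudo_riemannian_metric_def by (simp add: associated_metric_def)
qed

lemma conjugate_rel_endo_alt:
  assumes "almost_complex_structure A J" and "linear_connection A D"
    and "X \<in> vector_fields A" and "Y \<in> vector_fields A"
  shows "- app J (D X (app J Y)) = D X Y - app J (cov_deriv_endo D J X Y)"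
proof -
  have J: "smooth_endo A J" and JJ: "\<And>p v. v \<in> tangent_space A p \<Longrightarrow> J p (J p v) = - v"
    using assms(1) unfolding almost_complex_structure_def by simp_all
  have JX: "app J Y \<in> vector_fields A"
    using J assms(4) unfolding smooth_endo_def by simp
  have D: "\<And>X Y. X \<in> vector_fields A \<Longrightarrow> Y \<in> vector_fields A \<Longrightarrow> D X Y \<in> vector_fields A"
    using assms(2) unfolding linear_connection_def by simp
  have a: "D X (app J Y) p \<in> tangent_space A p" and b: "D X Y p \<in> tangent_space A p" for p
    using D[OF assms(3) JX] D[OF assms(3,4)] unfolding vector_fields_def by simp_all
  have c: "J p (D X Y p) \<in> tangent_space A p" for p
    using J b unfolding smooth_endo_def by simp
  have d: "scl (- 1) (J p (D X Y p)) \<in> tangent_space A p" for p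
    using c[of p] unfolding tangent_space_def scl_def by (auto simp: algebra_simps)
  have "J p (D X (app J Y) p - J p (D X Y p)) = J p (D X (app J Y) p) + D X Y p" for p
  proof -
    have "J p (D X (app J Y) p - J p (D X Y p)) = J p (D X (app J Y) p + scl (- 1) (J p (D X Y p)))"
      by (simp add: scl_minus_one)
    also have "\<dots> = J p (D X (app J Y) p) + scl (- 1) (J p (J p (D X Y p)))"
      using J a[of p] c[of p] d[of p] unfolding smooth_endo_def by simp
    also have "\<dots> = J p (D X (app J Y) p) + D X Y p"
      using JJ[OF b] by (simp add: scl_minus_one)
    finally show ?thesis .
  qed
  then show ?thesis
    by (simp add: cov_deriv_endo_def app_def fun_eq_iff)
qed

end

theory Submission
  imports Defs
begin

text \<open>
  Writing \<open>h\<close> for the metric and \<open>k = h(\<cdot>, J \<cdot>)\<close> for its associated metric, substituting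
  \<open>JZ\<close> for \<open>Z\<close> (respectively \<open>JY\<close> for \<open>Y\<close>) in the conjugacy relation and using
  \<open>D' = - J D J\<close> shows that both \<open>D\<close> and \<open>D'\<close> are compatible with \<open>k\<close>. Being torsion free, both are
  the Levi-Civita connection of \<open>k\<close>, so \<open>D = D'\<close>. Hence \<open>D\<close> commutes with \<open>J\<close>, and the conjugacy
  relation says that \<open>D\<close> is the Levi-Civita connection of \<open>h\<close>. For \<open>h = g\<close> this is the first claim;
  for \<open>h\<close> the associated metric of \<open>g\<close>, compatibility passes back to \<open>g\<close> because \<open>J\<close> is parallel.

  Nondegeneracy is a pointwise condition on derivations, whereas the uniqueness argument only tests
  against global vector fields, so one needs that every derivation at a point extends to a smooth
  vector field. This rests on bump functions and Hadamard's lemma.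
\<close>

section \<open>Calculus of smooth maps\<close>

text \<open>Derivatives in \<open>Ck_on\<close> are taken at x, not within S, so agreement on S
  controls them only because S is open.\<close>

lemma Ck_on_cong:
  fixes f :: "'e::euclidean_space \<Rightarrow> 'f::real_normed_vector"
  assumes "open S" "\<And>x. x \<in> S \<Longrightarrow> f x = g x" "Ck_on k S f"
  shows "Ck_on k S g"
  using assms(2,3)
proof (induction k arbitrary: f g)
  case 0
  then show ?case using continuous_on_eq[of S f g] by simp
next
  case (Suc k)
  have d: "(g has_derivative frechet_derivative f (at x)) (at x)" if "x \<in> S" for x
  proof -
    have "(f has_derivative frechet_derivative f (at x)) (at x)"
      using Suc.prems(2) that by (simp add: frechet_derivative_works[symmetric])
    then show ?thesis
      by (rule has_derivative_transform_within_open[OF _ assms(1) that Suc.prems(1)])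
  qed
  have "Ck_on k S (\<lambda>x. frechet_derivative g (at x) v)" for v
    by (rule Suc.IH[of "\<lambda>x. frechet_derivative f (at x) v"])
      (use Suc.prems(2) frechet_derivative_at[OF d] in auto)
  then show ?case using d by (auto simp: differentiable_def)
qed

text \<open>The working introduction rule: any explicit derivative may stand in for
  \<open>frechet_derivative\<close>, by uniqueness of derivatives.\<close>

lemma Ck_on_Suc_has_derivative:
  fixes f :: "'e::euclidean_space \<Rightarrow> 'f::real_normed_vector"
  assumes S: "open S" and d: "\<And>x. x \<in> S \<Longrightarrow> (f has_derivative f' x) (at x)"
    and c: "\<And>v. Ck_on k S (\<lambda>x. f' x v)"
  shows "Ck_on (Suc k) S f"
proof -
  have "Ck_on k S (\<lambda>x. frechet_derivative f (at x) v)" for v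
    by (rule Ck_on_cong[OF S _ c[of v]]) (simp add: frechet_derivative_at[OF d])
  then show ?thesis using d by (auto simp: differentiable_def)
qed

lemma Ck_on_has_derivative:
  "Ck_on (Suc k) S f \<Longrightarrow> x \<in> S \<Longrightarrow> (f has_derivative frechet_derivative f (at x)) (at x)"
  by (simp add: frechet_derivative_works[symmetric])

lemma Ck_on_subset: "Ck_on k S f \<Longrightarrow> T \<subseteq> S \<Longrightarrow> Ck_on k T f"
  by (induction k arbitrary: f) (auto intro: continuous_on_subset)

lemma Ck_on_SucD: "Ck_on (Suc k) S f \<Longrightarrow> Ck_on k S f"
proof (induction k arbitrary: f)
  case 0
  then show ?case
    by (auto intro!: continuous_at_imp_continuous_on differentiable_imp_continuous_within)
qed simp

lemma Ck_on_imp_continuous_on: "Ck_on k S f \<Longrightarrow> continuous_on S f"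
  by (induction k) (auto dest: Ck_on_SucD simp del: Ck_on.simps(2))

lemma Ck_on_Un:
  "open S \<Longrightarrow> open T \<Longrightarrow> Ck_on k S f \<Longrightarrow> Ck_on k T f \<Longrightarrow> Ck_on k (S \<union> T) f"
  by (induction k arbitrary: f) (auto intro: continuous_on_open_Un)

lemma Ck_on_const: "open S \<Longrightarrow> Ck_on k S (\<lambda>x. c)"
  by (induction k arbitrary: c) (auto intro!: Ck_on_Suc_has_derivative[where f'="\<lambda>x v. 0"])

lemma Ck_on_add:
  assumes "open S" "Ck_on k S f" "Ck_on k S g"
  shows "Ck_on k S (\<lambda>x. f x + g x)"
  using assms(2,3)
proof (induction k arbitrary: f g)
  case (Suc k)
  show ?case
    by (rule Ck_on_Suc_has_derivative[OF assms(1) has_derivative_add[OF Ck_on_has_derivative Ck_on_has_derivative]])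
      (use Suc in auto)
qed (auto intro: continuous_intros)

lemma Ck_on_sum:
  assumes "open S" "\<And>i. i \<in> I \<Longrightarrow> Ck_on k S (f i)"
  shows "Ck_on k S (\<lambda>x. \<Sum>i\<in>I. f i x)"
  using assms(2)
  by (induction I rule: infinite_finite_induct) (auto intro: Ck_on_add Ck_on_const assms(1))

lemma (in bounded_linear) Ck_on:
  assumes "open S" "Ck_on k S g"
  shows "Ck_on k S (\<lambda>x. f (g x))"
  using assms(2)
proof (induction k arbitrary: g)
  case 0
  then show ?case by (auto intro: continuous_on)
next
  case (Suc k)
  show ?case
    by (rule Ck_on_Suc_has_derivative[OF assms(1) has_derivative[OF Ck_on_has_derivative]])
      (use Suc in auto)
qed

text \<open>By the product rule the derivative is a sum of two terms of the same bilinear shape, so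
  the induction closes; the undifferentiated factors are lowered by one order with
  \<open>Ck_on_SucD\<close>.\<close>

lemma (in bounded_bilinear) Ck_on:
  assumes "open S" "Ck_on k S f" "Ck_on k S g"
  shows "Ck_on k S (\<lambda>x. prod (f x) (g x))"
  using assms(2,3)
proof (induction k arbitrary: f g)
  case 0
  then show ?case by (auto intro: continuous_on)
next
  case (Suc k)
  show ?case
    by (rule Ck_on_Suc_has_derivative[OF assms(1) FDERIV[OF Ck_on_has_derivative Ck_on_has_derivative]])
      (use Suc Ck_on_SucD[OF Suc.prems(1)] Ck_on_SucD[OF Suc.prems(2)] in
        \<open>auto intro!: Ck_on_add assms(1)\<close>)
qed

lemma linear_Basis_expansion:
  fixes L :: "'e::euclidean_space \<Rightarrow> 'f::real_vector"
  assumes "linear L"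
  shows "L v = (\<Sum>b\<in>Basis. (v \<bullet> b) *\<^sub>R L b)"
  using assms by (subst euclidean_representation[of v, symmetric])
    (simp only: linear_sum linear_scale)

lemma Ck_on_compose:
  fixes f :: "'f::euclidean_space \<Rightarrow> 'g::real_normed_vector" and g :: "'e::euclidean_space \<Rightarrow> 'f"
  assumes "open S" "open T" "g ` S \<subseteq> T" "Ck_on k T f" "Ck_on k S g"
  shows "Ck_on k S (\<lambda>x. f (g x))"
  using assms(4,5)
proof (induction k arbitrary: f)
  case 0
  then show ?case using assms(3) by (auto intro: continuous_on_compose2)
next
  case (Suc k)
  let ?Df = "\<lambda>x. frechet_derivative f (at x)" and ?Dg = "\<lambda>x. frechet_derivative g (at x)"
  show ?case
  proof (rule Ck_on_Suc_has_derivative[OF assms(1)])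
    fix x assume x: "x \<in> S"
    have df: "(f has_derivative ?Df (g x)) (at (g x))"
      using Ck_on_has_derivative[OF Suc.prems(1)] x assms(3) by blast
    have "((\<lambda>x. f (g x)) has_derivative (\<lambda>v. ?Df (g x) (?Dg x v))) (at x)"
      by (rule has_derivative_compose[OF Ck_on_has_derivative[OF Suc.prems(2) x] df])
    \<comment> \<open>The direction in which f is differentiated varies with x, but the induction
      hypothesis speaks of fixed directions only. Expanding in the basis leaves the fixed directions
      b, with coefficients that are smooth in x.\<close>
    then show "((\<lambda>x. f (g x)) has_derivative
        (\<lambda>v. \<Sum>b\<in>Basis. (?Dg x v \<bullet> b) *\<^sub>R ?Df (g x) b)) (at x)"
      by (subst (asm) linear_Basis_expansion[OF has_derivative_linear[OF df]])
  next
    fix v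
    show "Ck_on k S (\<lambda>x. \<Sum>b\<in>Basis. (?Dg x v \<bullet> b) *\<^sub>R ?Df (g x) b)"
      using Suc.prems Suc.IH Ck_on_SucD[OF Suc.prems(2)]
      by (intro Ck_on_sum bounded_bilinear.Ck_on[OF bounded_bilinear_scaleR]
          bounded_linear.Ck_on[OF bounded_linear_inner_left] assms(1)) auto
  qed
qed

lemma Ck_on_ident: "open S \<Longrightarrow> Ck_on k S (\<lambda>x. x)"
  by (cases k) (auto intro!: Ck_on_Suc_has_derivative[where f'="\<lambda>x v. v"] Ck_on_const continuous_on_id)

section \<open>Bump functions\<close>

text \<open>\<open>flat 0\<close> is the classical smooth function exp(-1/t), flat at 0. The powers
  of 1/t make the spans of the family closed under differentiation.\<close>

definition flat :: "nat \<Rightarrow> real \<Rightarrow> real" where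
  "flat n t = (if t > 0 then exp (- inverse t) * inverse t ^ n else 0)"

text \<open>With s = 1/t the limit from the right is that of \<open>s ^ n / exp s\<close> at
  infinity.\<close>

lemma flat_tendsto_0: "(flat n \<longlongrightarrow> 0) (at 0)"
proof -
  have "((\<lambda>s::real. s ^ n / exp s) \<longlongrightarrow> 0) at_top" by (rule tendsto_power_div_exp_0)
  from filterlim_compose[OF this filterlim_inverse_at_top_right]
  have "((\<lambda>t. inverse t ^ n / exp (inverse t)) \<longlongrightarrow> (0::real)) (at_right 0)" .
  then have r: "(flat n \<longlongrightarrow> 0) (at_right 0)"
    by (rule Lim_transform_eventually)
      (auto simp: flat_def exp_minus field_simps
        intro: eventually_mono[OF eventually_at_right_less])
  have l: "(flat n \<longlongrightarrow> 0) (at_left 0)"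
    by (rule tendsto_eventually) (auto simp: flat_def eventually_at_filter)
  from l r show ?thesis by (rule filterlim_split_at)
qed

lemma flat_has_derivative:
  "(flat n has_real_derivative flat (n + 2) t - n * flat (n + 1) t) (at t)"
proof -
  consider "t > 0" | "t < 0" | "t = 0" by linarith
  then show ?thesis
  proof cases
    case 1
    have "((\<lambda>t. exp (- inverse t) * inverse t ^ n) has_real_derivative
        flat (n + 2) t - n * flat (n + 1) t) (at t)"
      using 1 by (cases n) (auto intro!: derivative_eq_intros simp: flat_def algebra_simps power2_eq_square,
        metis One_nat_def power_eq_if)
    then show ?thesis
      by (rule has_field_derivative_transform_within_open[where S="{0<..}"]) (use 1 in \<open>auto simp: flat_def\<close>)
  next
    case 2
    have "((\<lambda>t. 0) has_real_derivative flat (n + 2) t - n * flat (n + 1) t) (at t)"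
      using 2 by (auto simp: flat_def)
    then show ?thesis
      by (rule has_field_derivative_transform_within_open[where S="{..<0}"]) (use 2 in \<open>auto simp: flat_def\<close>)
  next
    \<comment> \<open>Dividing by y raises the power of 1/y by one, so the difference quotient of
      \<open>flat n\<close> at 0 is \<open>flat (Suc n)\<close>, whose limit is known.\<close>
    case 3
    have "((\<lambda>y. (flat n y - flat n 0) / (y - 0)) \<longlongrightarrow> 0) (at 0)"
      by (rule Lim_transform_eventually[OF flat_tendsto_0[of "Suc n"]])
        (auto simp: flat_def field_simps eventually_at_filter)
    then show ?thesis by (simp add: has_field_derivative_iff 3 flat_def)
  qed
qed

lemma Ck_on_flat: "Ck_on k UNIV (flat n)"
proof (induction k arbitrary: n)
  case 0
  then show ?case
    by (auto intro!: continuous_at_imp_continuous_on DERIV_isCont flat_has_derivative)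
next
  case (Suc k)
  have "Ck_on k UNIV (\<lambda>x. (flat (n + 2) x + (- real n) * flat (n + 1) x) * v)" for v
    by (intro bounded_bilinear.Ck_on[OF bounded_bilinear_mult] Ck_on_add Ck_on_const Suc.IH open_UNIV)
  moreover have "(flat n has_derivative (\<lambda>v. (flat (n + 2) x + (- real n) * flat (n + 1) x) * v)) (at x)" for x
    using flat_has_derivative[of n x] unfolding has_field_derivative_def by simp
  ultimately show ?case
    by (intro Ck_on_Suc_has_derivative) auto
qed

lemma Cinf_bump:
  fixes a :: "'e::euclidean_space"
  assumes "r > 0"
  obtains \<beta> :: "'e \<Rightarrow> real" where "Cinf_on UNIV \<beta>" "\<beta> a = 1" "\<And>x. x \<notin> cball a r \<Longrightarrow> \<beta> x = 0"
proof
  \<comment> \<open>The squared norm is smooth at a, unlike the norm; the last factor normalises the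
    value at a to 1. Subtractions are written as sums to fit \<open>Ck_on_add\<close>.\<close>
  let ?\<beta> = "\<lambda>x. flat 0 (r\<^sup>2 + - 1 * ((x + - a) \<bullet> (x + - a))) * inverse (flat 0 (r\<^sup>2))"
  have "Ck_on k UNIV (\<lambda>x. flat 0 (r\<^sup>2 + - 1 * ((x + - a) \<bullet> (x + - a))))" for k
    by (rule Ck_on_compose[OF _ _ _ Ck_on_flat[of k 0]])
      (intro bounded_bilinear.Ck_on[OF bounded_bilinear_mult] bounded_bilinear.Ck_on[OF bounded_bilinear_inner]
          Ck_on_add Ck_on_const Ck_on_ident open_UNIV subset_UNIV)+
  then show "Cinf_on UNIV ?\<beta>"
    unfolding Cinf_on_def
    by (intro allI bounded_bilinear.Ck_on[OF bounded_bilinear_mult] Ck_on_const open_UNIV)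
  show "?\<beta> a = 1" using assms by (simp add: flat_def)
  fix x assume "x \<notin> cball a r"
  then have "r < norm (x - a)" by (simp add: dist_norm norm_minus_commute)
  then have "r\<^sup>2 < (norm (x - a))\<^sup>2" using assms by (simp add: power_strict_mono)
  then show "?\<beta> x = 0" by (simp add: flat_def power2_norm_eq_inner)
qed

section \<open>Hadamard's lemma\<close>

lemma segment_mem:
  assumes "convex S" "a \<in> S" "x \<in> S" "0 \<le> t" "t \<le> 1"
  shows "a + t *\<^sub>R (x - a) \<in> S"
proof -
  have "a + t *\<^sub>R (x - a) = (1 - t) *\<^sub>R a + t *\<^sub>R x" by (simp add: algebra_simps)
  then show ?thesis using convexD_alt[OF assms(1-3), of t] assms by simp
qed

lemma continuous_on_slice:
  assumes "continuous_on (S \<times> T) (\<lambda>(x, t). f x t)" "x \<in> S"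
  shows "continuous_on T (f x)"
proof -
  have "continuous_on T (\<lambda>t. (x, t))"
    by (intro continuous_on_Pair continuous_on_const continuous_on_id)
  from continuous_on_compose2[OF assms(1) this] assms(2) show ?thesis by auto
qed

text \<open>Differentiation under the integral sign. The weight \<open>t ^ n\<close> is there for
  the induction: differentiating in x produces a factor t, so F passes to a directional derivative
  and n to \<open>Suc n\<close>.\<close>

lemma Ck_on_radial_integral:
  fixes F :: "'e::euclidean_space \<Rightarrow> real"
  assumes S: "open S" "convex S" "a \<in> S" and "Ck_on k S F"
  shows "Ck_on k S (\<lambda>x. integral (cbox 0 1) (\<lambda>t. t ^ n * F (a + t *\<^sub>R (x - a))))"
  using assms(4)
proof (induction k arbitrary: F n)
  have cont: "continuous_on (S \<times> cbox 0 1) (\<lambda>(x, t). t ^ n * F (a + t *\<^sub>R (x - a)))"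
    if "continuous_on S F" for F :: "'e \<Rightarrow> real" and n
    unfolding split_beta
    by (intro continuous_intros continuous_on_compose2[OF that]) (auto intro: segment_mem S)
  {
    case 0
    then show ?case using integral_continuous_on_param[OF cont] by simp
  next
    case (Suc k)
    let ?D = "\<lambda>y. frechet_derivative F (at y)"
    let ?L = "\<lambda>x t v. t ^ Suc n * ?D (a + t *\<^sub>R (x - a)) v"
    have cF: "continuous_on S F"
      by (rule Ck_on_imp_continuous_on[OF Suc.prems])
    have cD: "continuous_on S (\<lambda>x. ?D x v)" for v
      by (rule Ck_on_imp_continuous_on[of k]) (use Suc.prems in simp)
    have d: "((\<lambda>x. t ^ n * F (a + t *\<^sub>R (x - a))) has_derivative ?L x t) (at x)"
      if "x \<in> S" "t \<in> cbox 0 1" for x t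
    proof -
      have dF: "(F has_derivative ?D (a + t *\<^sub>R (x - a))) (at (a + t *\<^sub>R (x - a)))"
        using that by (intro Ck_on_has_derivative[OF Suc.prems] segment_mem S) auto
      have "((\<lambda>x. F (a + t *\<^sub>R (x - a))) has_derivative
          (\<lambda>v. ?D (a + t *\<^sub>R (x - a)) (t *\<^sub>R v))) (at x)"
        by (rule has_derivative_compose[where f="\<lambda>x. a + t *\<^sub>R (x - a)", OF _ dF]) (auto intro!: derivative_eq_intros)
      then have "((\<lambda>x. t ^ n * F (a + t *\<^sub>R (x - a))) has_derivative
          (\<lambda>v. t ^ n * ?D (a + t *\<^sub>R (x - a)) (t *\<^sub>R v))) (at x)"
        by (auto intro!: derivative_eq_intros)
      then show ?thesis
        by (simp add: linear_scale[OF has_derivative_linear[OF dF]] mult_ac)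
    qed
    then have L: "blinfun_apply (Blinfun (?L x t)) = ?L x t" if "x \<in> S" "t \<in> cbox 0 1" for x t
      using that by (intro bounded_linear_Blinfun_apply has_derivative_bounded_linear)
    \<comment> \<open>The Leibniz rule needs the derivative to be continuous as a bounded linear map
      in (x, t); in finite dimension this can be checked for each direction v separately.\<close>
    have cL: "continuous_on (S \<times> cbox 0 1) (\<lambda>(x, t). Blinfun (?L x t))"
      unfolding split_beta
    proof (rule continuous_on_blinfun_componentwise)
      fix v :: 'e
      show "continuous_on (S \<times> cbox 0 1) (\<lambda>p. blinfun_apply (Blinfun (?L (fst p) (snd p))) v)"
        using cont[OF cD, of "Suc n" v] by (rule continuous_on_eq) (auto simp: L simp del: power_Suc)
    qed
    show ?case
    proof (rule Ck_on_Suc_has_derivative[OF S(1)])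
      fix x assume x: "x \<in> S"
      have eq: "blinfun_apply (integral (cbox 0 1) (\<lambda>t. Blinfun (?L x t))) =
          (\<lambda>v. integral (cbox 0 1) (\<lambda>t. ?L x t v))"
      proof
        fix v
        have "blinfun_apply (integral (cbox 0 1) (\<lambda>t. Blinfun (?L x t))) v =
            integral (cbox 0 1) (\<lambda>t. blinfun_apply (Blinfun (?L x t)) v)"
          by (rule blinfun_apply_integral[OF integrable_continuous[OF continuous_on_slice[OF cL x]]])
        also have "\<dots> = integral (cbox 0 1) (\<lambda>t. ?L x t v)"
          by (rule integral_cong) (simp only: L[OF x])
        finally show "blinfun_apply (integral (cbox 0 1) (\<lambda>t. Blinfun (?L x t))) v =
            integral (cbox 0 1) (\<lambda>t. ?L x t v)" .
      qed
      have "((\<lambda>x. integral (cbox 0 1) (\<lambda>t. t ^ n * F (a + t *\<^sub>R (x - a)))) has_derivative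
          blinfun_apply (integral (cbox 0 1) (\<lambda>t. Blinfun (?L x t)))) (at x within S)"
      proof (rule leibniz_rule[OF _ _ cL x S(2)])
        fix y and t :: real assume "y \<in> S" "t \<in> cbox 0 1"
        then show "((\<lambda>x. t ^ n * F (a + t *\<^sub>R (x - a))) has_derivative
            blinfun_apply (Blinfun (?L y t))) (at y within S)"
          unfolding L[OF \<open>y \<in> S\<close> \<open>t \<in> cbox 0 1\<close>] by (rule has_derivative_at_withinI[OF d])
      next
        fix y assume "y \<in> S"
        then show "(\<lambda>t. t ^ n * F (a + t *\<^sub>R (y - a))) integrable_on cbox 0 1"
          by (rule integrable_continuous[OF continuous_on_slice[OF cont[OF cF]]])
      qed
      then show "((\<lambda>x. integral (cbox 0 1) (\<lambda>t. t ^ n * F (a + t *\<^sub>R (x - a)))) has_derivative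
          (\<lambda>v. integral (cbox 0 1) (\<lambda>t. ?L x t v))) (at x)"
        unfolding eq at_within_open[OF x S(1)] .
    next
      fix v
      show "Ck_on k S (\<lambda>x. integral (cbox 0 1) (\<lambda>t. ?L x t v))"
        using Suc.prems by (intro Suc.IH) simp
    qed
  }
qed

text \<open>Integrate the derivative of F along the segment from a to x and expand x - a in the
  basis; G b averages the b-th partial derivative over the segment.\<close>

lemma Hadamard:
  fixes F :: "'e::euclidean_space \<Rightarrow> real"
  assumes S: "open S" "convex S" "a \<in> S" and F: "Cinf_on S F"
  obtains G where "\<And>b. Cinf_on S (G b)" "\<And>b. G b a = frechet_derivative F (at a) b"
    "\<And>x. x \<in> S \<Longrightarrow> F x = F a + (\<Sum>b\<in>Basis. ((x - a) \<bullet> b) * G b x)"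
proof
  let ?D = "\<lambda>y. frechet_derivative F (at y)"
  \<comment> \<open>The factor \<open>t ^ 0\<close> makes this the case n = 0 of
    \<open>Ck_on_radial_integral\<close>.\<close>
  let ?G = "\<lambda>b x. integral (cbox 0 1) (\<lambda>t. t ^ 0 * ?D (a + t *\<^sub>R (x - a)) b)"
  have D: "Ck_on k S (\<lambda>x. ?D x b)" for k b
    using F Ck_on.simps(2) unfolding Cinf_on_def by blast
  show "Cinf_on S (?G b)" for b
    unfolding Cinf_on_def by (intro allI Ck_on_radial_integral S D)
  show "?G b a = ?D a b" for b by simp
  fix x assume x: "x \<in> S"
  have dF: "(F has_derivative ?D y) (at y)" if "y \<in> S" for y
    using F Ck_on_has_derivative that unfolding Cinf_on_def by blast
  have "((\<lambda>t. ?D (a + t *\<^sub>R (x - a)) (x - a)) has_integral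
      F (a + 1 *\<^sub>R (x - a)) - F (a + 0 *\<^sub>R (x - a))) {0..1}"
  proof (rule fundamental_theorem_of_calculus)
    fix t :: real assume t: "t \<in> {0..1}"
    have y: "a + t *\<^sub>R (x - a) \<in> S" using t x by (intro segment_mem S) auto
    have "((\<lambda>t. F (a + t *\<^sub>R (x - a))) has_derivative
        (\<lambda>s. ?D (a + t *\<^sub>R (x - a)) (s *\<^sub>R (x - a)))) (at t within {0..1})"
      by (rule has_derivative_compose[where f="\<lambda>t. a + t *\<^sub>R (x - a)", OF _ dF[OF y]]) (auto intro!: derivative_eq_intros)
    then show "((\<lambda>t. F (a + t *\<^sub>R (x - a))) has_vector_derivative
        ?D (a + t *\<^sub>R (x - a)) (x - a)) (at t within {0..1})"
      by (simp add: has_vector_derivative_def linear_scale[OF has_derivative_linear[OF dF[OF y]]])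
  qed simp
  then have "F x - F a = integral (cbox 0 1) (\<lambda>t. ?D (a + t *\<^sub>R (x - a)) (x - a))"
    by (simp add: integral_unique)
  also have "\<dots> = integral (cbox 0 1) (\<lambda>t. \<Sum>b\<in>Basis. ((x - a) \<bullet> b) * ?D (a + t *\<^sub>R (x - a)) b)"
  proof (rule integral_cong)
    fix t :: real assume "t \<in> cbox 0 1"
    then have "a + t *\<^sub>R (x - a) \<in> S" using x by (intro segment_mem S) auto
    from linear_Basis_expansion[OF has_derivative_linear[OF dF[OF this]], of "x - a"]
    show "?D (a + t *\<^sub>R (x - a)) (x - a) = (\<Sum>b\<in>Basis. ((x - a) \<bullet> b) * ?D (a + t *\<^sub>R (x - a)) b)"
      by simp
  qed
  also have "\<dots> = (\<Sum>b\<in>Basis. integral (cbox 0 1) (\<lambda>t. ((x - a) \<bullet> b) * ?D (a + t *\<^sub>R (x - a)) b))"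
  proof (rule integral_sum)
    fix b :: 'e
    have "continuous_on (cbox 0 1) (\<lambda>t. ?D (a + t *\<^sub>R (x - a)) b)"
      by (rule continuous_on_compose2[OF Ck_on_imp_continuous_on[OF D[of 0 b]]])
        (use x in \<open>auto intro!: continuous_intros segment_mem S\<close>)
    then show "(\<lambda>t. ((x - a) \<bullet> b) * ?D (a + t *\<^sub>R (x - a)) b) integrable_on cbox 0 1"
      by (intro integrable_continuous continuous_intros)
  qed simp
  finally show "F x = F a + (\<Sum>b\<in>Basis. ((x - a) \<bullet> b) * ?G b x)" by simp
qed

section \<open>Extending tangent vectors to vector fields\<close>

lemma smooth_manifold_chart:
  assumes "smooth_manifold A" "(U, \<phi>) \<in> A"
  shows "open U" "open (\<phi> ` U)" "homeomorphism U (\<phi> ` U) \<phi> (inv_into U \<phi>)"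
  using assms unfolding smooth_manifold_def by auto

lemma homeomorphism_open_image:
  assumes "homeomorphism S T f g" "open T" "open O'" "O' \<subseteq> S"
  shows "open (f ` O')"
proof -
  have "openin (top_of_set T) (f ` O')"
    by (rule homeomorphism_imp_open_map[OF assms(1) open_subset[OF assms(4,3)]])
  then show ?thesis using assms(2) by (simp add: openin_open_eq)
qed

lemma Cinf_on_subset: "Cinf_on S f \<Longrightarrow> T \<subseteq> S \<Longrightarrow> Cinf_on T f"
  unfolding Cinf_on_def by (blast intro: Ck_on_subset)

lemma smooth_fun_const: "smooth_manifold A \<Longrightarrow> (\<lambda>x. c) \<in> smooth_fun A"
  unfolding smooth_fun_def Cinf_on_def by (auto simp: comp_def dest: smooth_manifold_chart(2) intro: Ck_on_const)

lemma smooth_fun_add: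
  "smooth_manifold A \<Longrightarrow> f \<in> smooth_fun A \<Longrightarrow> h \<in> smooth_fun A \<Longrightarrow> f + h \<in> smooth_fun A"
  unfolding smooth_fun_def Cinf_on_def
  by (auto simp: comp_def dest: smooth_manifold_chart(2) intro!: Ck_on_add)

lemma smooth_fun_mult:
  "smooth_manifold A \<Longrightarrow> f \<in> smooth_fun A \<Longrightarrow> h \<in> smooth_fun A \<Longrightarrow> f * h \<in> smooth_fun A"
  unfolding smooth_fun_def Cinf_on_def
  by (auto simp: comp_def dest: smooth_manifold_chart(2)
      intro!: bounded_bilinear.Ck_on[OF bounded_bilinear_mult])

definition chart_extend :: "'a set \<Rightarrow> ('a \<Rightarrow> 'e) \<Rightarrow> ('e \<Rightarrow> real) \<Rightarrow> ('e \<Rightarrow> real) \<Rightarrow> 'a \<Rightarrow> real" where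
  "chart_extend U \<phi> \<beta> H q = (if q \<in> U then \<beta> (\<phi> q) * H (\<phi> q) else 0)"

text \<open>Every chart domain V is covered by two open sets: the part over S, where the extension
  is a product of smooth composites, and the complement of the support set \<open>?K\<close>, where
  it is zero.\<close>

lemma chart_extend_smooth:
  fixes A :: "('a::{t2_space,second_countable_topology}, 'e::euclidean_space) atlas"
  assumes A: "smooth_manifold A" and U: "(U, \<phi>) \<in> A"
    and \<beta>: "Cinf_on UNIV \<beta>" "\<And>x. x \<notin> C \<Longrightarrow> \<beta> x = 0" "compact C" "C \<subseteq> S"
    and S: "open S" "S \<subseteq> \<phi> ` U" and H: "Cinf_on S H"
  shows "chart_extend U \<phi> \<beta> H \<in> smooth_fun A"
  unfolding smooth_fun_def
proof safe
  fix V \<psi> assume V: "(V, \<psi>) \<in> A"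
  note cU = smooth_manifold_chart[OF A U] and cV = smooth_manifold_chart[OF A V]
  let ?i = "inv_into U \<phi>" and ?j = "inv_into V \<psi>"
  have i: "?i (\<phi> q) = q" if "q \<in> U" for q using cU(3) that by (simp add: homeomorphism_def)
  have j: "?j (\<psi> q) = q" if "q \<in> V" for q using cV(3) that by (simp add: homeomorphism_def)
  let ?K = "?i ` C" and ?T = "?i ` S"
  have "continuous_on C ?i"
    using cU(3) \<beta>(4) S(2) by (meson continuous_on_subset homeomorphism_def)
  \<comment> \<open>Compactness of C matters here: it makes the preimage closed in the whole
    Hausdorff space, not merely relative to U.\<close>
  then have K: "closed ?K" using \<beta>(3) by (intro compact_imp_closed compact_continuous_image)
  have T: "open ?T" "?T \<subseteq> U"
    using homeomorphism_open_image[OF homeomorphism_symD[OF cU(3)] cU(1) S] S(2) i by auto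
  have o1: "open (\<psi> ` (V \<inter> ?T))" and o2: "open (\<psi> ` (V - ?K))"
    using cV(1) T(1) K by (auto intro!: homeomorphism_open_image[OF cV(3,2)])
  have cover: "\<psi> ` V = \<psi> ` (V \<inter> ?T) \<union> \<psi> ` (V - ?K)"
    using \<beta>(4) by blast
  show "Cinf_on (\<psi> ` V) (chart_extend U \<phi> \<beta> H \<circ> ?j)"
    unfolding Cinf_on_def cover
  proof (intro allI Ck_on_Un o1 o2)
    fix k
    let ?\<theta> = "\<phi> \<circ> ?j"
    have "Cinf_on (\<psi> ` (V \<inter> U)) ?\<theta>"
      using A U V unfolding smooth_manifold_def by blast
    then have "Cinf_on (\<psi> ` (V \<inter> ?T)) ?\<theta>"
      by (rule Cinf_on_subset) (use T in blast)
    then have \<theta>: "Ck_on k (\<psi> ` (V \<inter> ?T)) ?\<theta>"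
      unfolding Cinf_on_def ..
    have im: "?\<theta> ` (\<psi> ` (V \<inter> ?T)) \<subseteq> S"
      using j S(2) by (auto simp: f_inv_into_f subset_iff)
    have "Ck_on k (\<psi> ` (V \<inter> ?T)) (\<lambda>x. \<beta> (?\<theta> x) * H (?\<theta> x))"
      using \<beta>(1) H unfolding Cinf_on_def
      by (intro bounded_bilinear.Ck_on[OF bounded_bilinear_mult] o1
          Ck_on_compose[OF o1 open_UNIV subset_UNIV _ \<theta>] Ck_on_compose[OF o1 S(1) im _ \<theta>]) auto
    then show "Ck_on k (\<psi> ` (V \<inter> ?T)) (chart_extend U \<phi> \<beta> H \<circ> ?j)"
      by (rule Ck_on_cong[OF o1, rotated]) (use T j in \<open>auto simp: chart_extend_def\<close>)
    have "\<beta> (\<phi> q) = 0" if "q \<in> U" "q \<notin> ?K" for q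
      using that i[OF that(1)] by (intro \<beta>(2)) force
    then show "Ck_on k (\<psi> ` (V - ?K)) (chart_extend U \<phi> \<beta> H \<circ> ?j)"
      by (intro Ck_on_cong[OF o2 _ Ck_on_const[OF o2, of _ 0]]) (auto simp: chart_extend_def j)
  qed
qed

section \<open>Derivations at a point\<close>

context
  fixes A :: "('a::{t2_space,second_countable_topology}, 'e::euclidean_space) atlas" and p v
  assumes A: "smooth_manifold A" and v: "v \<in> tangent_space A p"
begin

lemma tangent_add: "f \<in> smooth_fun A \<Longrightarrow> h \<in> smooth_fun A \<Longrightarrow> v (f + h) = v f + v h"
  and tangent_scale: "f \<in> smooth_fun A \<Longrightarrow> v (\<lambda>x. c * f x) = c * v f"
  and tangent_mult: "f \<in> smooth_fun A \<Longrightarrow> h \<in> smooth_fun A \<Longrightarrow> v (f * h) = f p * v h + h p * v f"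
  using v unfolding tangent_space_def by auto

text \<open>The product rule on 1 = 1 * 1 gives v 1 = 2 v 1, hence v 1 = 0; homogeneity does the
  rest.\<close>

lemma tangent_const: "v (\<lambda>x. c) = 0"
proof -
  have "v (\<lambda>x. 1) = v ((\<lambda>x. 1) * (\<lambda>x. 1))" by (simp add: times_fun_def)
  then have "v (\<lambda>x. 1) = 0"
    by (subst (asm) tangent_mult) (simp_all add: smooth_fun_const[OF A])
  then show ?thesis
    using tangent_scale[OF smooth_fun_const[OF A], of c 1] by simp
qed

text \<open>Both claims go through one induction, since v is additive only on smooth functions and
  the partial sums must be known to be smooth.\<close>

lemma tangent_sum:
  assumes "\<And>i. i \<in> I \<Longrightarrow> f i \<in> smooth_fun A"
  shows "(\<Sum>i\<in>I. f i) \<in> smooth_fun A \<and> v (\<Sum>i\<in>I. f i) = (\<Sum>i\<in>I. v (f i))"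
  using assms
proof (induction I rule: infinite_finite_induct)
  case (insert i I)
  then have fi: "f i \<in> smooth_fun A" and fI: "sum f I \<in> smooth_fun A"
    and v: "v (sum f I) = (\<Sum>i\<in>I. v (f i))" by auto
  show ?case
    unfolding sum.insert[OF insert.hyps] v[symmetric]
    by (intro conjI smooth_fun_add[OF A] tangent_add fi fI)
qed (simp_all add: smooth_fun_const[OF A] tangent_const zero_fun_def)

end

lemma sum_fun_apply: "(\<Sum>i\<in>I. f i) x = (\<Sum>i\<in>I. f i x)"
  by (induction I rule: infinite_finite_induct) auto

text \<open>
  With \<open>u\<^sub>b\<close>, \<open>k\<^sub>b\<close>, \<open>\<chi>\<close> the cut-off extensions of the coordinates, of the Hadamard quotients of \<open>f\<close>
  and of 1, the identity \<open>\<chi>\<^sup>2 (f - f p) = (\<Sum>b. u\<^sub>b * k\<^sub>b)\<close> holds globally. Applying \<open>w\<close> to it gives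
  \<open>w f = (\<Sum>b. w u\<^sub>b * \<partial>\<^sub>b f p)\<close> without first proving that derivations are local.
\<close>
lemma tangent_vector_extension:
  fixes A :: "('a::{t2_space,second_countable_topology}, 'e::euclidean_space) atlas"
  assumes A: "smooth_manifold A" and w: "w \<in> tangent_space A p"
  obtains X where "X \<in> vector_fields A" "X p = w"
proof -
  obtain U \<phi> where U: "(U, \<phi>) \<in> A" "p \<in> U"
    using A unfolding smooth_manifold_def by blast
  note cU = smooth_manifold_chart[OF A U(1)]
  let ?i = "inv_into U \<phi>"
  have i: "?i (\<phi> q) = q" if "q \<in> U" for q using cU(3) that by (simp add: homeomorphism_def)
  define a where "a = \<phi> p"
  obtain r where r: "r > 0" "ball a r \<subseteq> \<phi> ` U"
    using cU(2) U(2) unfolding a_def open_contains_ball by blast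
  \<comment> \<open>Half the radius puts the support in a compact ball inside the open ball on which
    the coordinate functions are to be smooth.\<close>
  obtain \<beta> :: "'e \<Rightarrow> real" where \<beta>: "Cinf_on UNIV \<beta>" "\<beta> a = 1" "\<And>x. x \<notin> cball a (r/2) \<Longrightarrow> \<beta> x = 0"
    using Cinf_bump[OF half_gt_zero[OF r(1)], of a] by blast
  have \<beta>0: "\<beta> x = 0" if "x \<notin> ball a r" for x using that r by (intro \<beta>(3)) auto
  let ?E = "chart_extend U \<phi> \<beta>"
  have E: "?E H \<in> smooth_fun A" if "Cinf_on (ball a r) H" for H
    by (rule chart_extend_smooth[OF A U(1) \<beta>(1) _ compact_cball[of a "r/2"] _ open_ball r(2) that])
      (use r \<beta>(3) in auto)
  have Ep: "?E H p = H a" for H using U(2) \<beta>(2) by (simp add: chart_extend_def a_def)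
  let ?F = "\<lambda>f x. f (?i x)"
  let ?D = "\<lambda>f x. frechet_derivative (?F f) (at x)"
  have F: "Cinf_on (\<phi> ` U) (?F f)" if "f \<in> smooth_fun A" for f
    using that U(1) unfolding smooth_fun_def comp_def by blast
  have D: "(?F f has_derivative ?D f (\<phi> q)) (at (\<phi> q))" if "f \<in> smooth_fun A" "q \<in> U" for f q
    using F[OF that(1)] that(2) Ck_on_has_derivative unfolding Cinf_on_def by blast
  \<comment> \<open>The coordinate vector of w, read off from the cut-off coordinates; X is the
    constant field c in the chart times the bump. Its value 0 on non-smooth f is the convention of
    \<open>tangent_space\<close>.\<close>
  define c where "c = (\<Sum>b\<in>Basis. w (?E (\<lambda>x. (x - a) \<bullet> b)) *\<^sub>R b)"
  define X where "X = (\<lambda>q f. if f \<in> smooth_fun A then ?E (\<lambda>x. ?D f x c) q else 0)"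
  have "X q \<in> tangent_space A q" for q
  proof -
    have "?D (f + h) (\<phi> q) c = ?D f (\<phi> q) c + ?D h (\<phi> q) c"
      if "f \<in> smooth_fun A" "h \<in> smooth_fun A" "q \<in> U" for f h
      using frechet_derivative_at[OF has_derivative_add[OF D[OF that(1,3)] D[OF that(2,3)]]]
      by (simp add: fun_eq_iff)
    moreover have "?D (\<lambda>x. k * f x) (\<phi> q) c = k * ?D f (\<phi> q) c"
      if "f \<in> smooth_fun A" "q \<in> U" for f k
      using frechet_derivative_at[OF has_derivative_mult_right[OF D[OF that], of k]]
      by (simp add: fun_eq_iff)
    moreover have "?D (f * h) (\<phi> q) c = f q * ?D h (\<phi> q) c + h q * ?D f (\<phi> q) c"
      if "f \<in> smooth_fun A" "h \<in> smooth_fun A" "q \<in> U" for f h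
      using frechet_derivative_at[OF has_derivative_mult[OF D[OF that(1,3)] D[OF that(2,3)]]] i[OF that(3)]
      by (simp add: fun_eq_iff mult.commute)
    moreover have "(\<lambda>x. k * f x) \<in> smooth_fun A" if "f \<in> smooth_fun A" for f k
      using smooth_fun_mult[OF A smooth_fun_const[OF A] that] by (simp add: times_fun_def)
    ultimately show ?thesis
      unfolding tangent_space_def X_def
      by (auto simp: chart_extend_def smooth_fun_add[OF A] smooth_fun_mult[OF A] algebra_simps)
  qed
  moreover have "(\<lambda>q. X q f) \<in> smooth_fun A" if "f \<in> smooth_fun A" for f
  proof -
    have "Cinf_on (ball a r) (\<lambda>x. ?D f x c)"
      using F[OF that] r(2) Ck_on.simps(2) Ck_on_subset unfolding Cinf_on_def by blast
    from E[OF this] show ?thesis using that by (simp add: X_def)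
  qed
  ultimately have "X \<in> vector_fields A" unfolding vector_fields_def by blast
  moreover have "X p f = w f" for f
  proof (cases "f \<in> smooth_fun A")
    case False
    then show ?thesis using w by (simp add: X_def tangent_space_def)
  next
    case f: True
    obtain G where G: "\<And>b. Cinf_on (ball a r) (G b)" "\<And>b. G b a = ?D f a b"
      "\<And>x. x \<in> ball a r \<Longrightarrow> ?F f x = ?F f a + (\<Sum>b\<in>Basis. ((x - a) \<bullet> b) * G b x)"
      by (rule Hadamard[OF open_ball convex_ball _ Cinf_on_subset[OF F[OF f] r(2)]]) (use r in auto)
    let ?u = "\<lambda>b. ?E (\<lambda>x. (x - a) \<bullet> b)" and ?k = "\<lambda>b. ?E (G b)"
      and ?\<chi> = "?E (\<lambda>x. 1)" and ?f0 = "f + (\<lambda>x. - f p)"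
    have "Cinf_on (ball a r) (\<lambda>x. (x + - a) \<bullet> b)" for b
      unfolding Cinf_on_def
      by (intro allI bounded_linear.Ck_on[OF bounded_linear_inner_left] Ck_on_add Ck_on_const Ck_on_ident open_ball)
    then have u: "?u b \<in> smooth_fun A" for b by (intro E) simp
    have k: "?k b \<in> smooth_fun A" for b by (intro E G)
    have \<chi>: "?\<chi> \<in> smooth_fun A" by (intro E) (simp add: Cinf_on_def Ck_on_const)
    have f0: "?f0 \<in> smooth_fun A" by (intro smooth_fun_add A f smooth_fun_const)
    have fp: "?F f a = f p" using U(2) i by (simp add: a_def)
    \<comment> \<open>Each product of \<open>?u b\<close> and \<open>?k b\<close> carries the bump
      twice, hence the square of \<open>?\<chi>\<close>. Away from the ball both sides vanish with
      the bump.\<close>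
    have decomp: "(?\<chi> * ?\<chi>) * ?f0 = (\<Sum>b\<in>Basis. ?u b * ?k b)"
    proof
      fix q
      show "((?\<chi> * ?\<chi>) * ?f0) q = (\<Sum>b\<in>Basis. ?u b * ?k b) q"
      proof (cases "q \<in> U \<and> \<phi> q \<in> ball a r")
        case True
        then have "f q - f p = (\<Sum>b\<in>Basis. ((\<phi> q - a) \<bullet> b) * G b (\<phi> q))"
          using G(3)[of "\<phi> q"] fp i by auto
        then show ?thesis using True
          by (simp add: sum_fun_apply chart_extend_def sum_distrib_left mult_ac)
      next
        case False
        then show ?thesis using \<beta>0 by (auto simp: sum_fun_apply chart_extend_def)
      qed
    qed
    \<comment> \<open>\<open>?f0\<close> vanishes at p and \<open>?\<chi>\<close> is 1 there, so
      only w \<open>?f0\<close> survives the product rule, and the constant f p contributes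
      nothing.\<close>
    have "w ((?\<chi> * ?\<chi>) * ?f0) = w f"
      using tangent_const[OF A w]
      by (simp add: tangent_mult[OF A w] smooth_fun_mult[OF A] \<chi> f0 Ep tangent_add[OF A w] f smooth_fun_const[OF A])
    moreover have "w (\<Sum>b\<in>Basis. ?u b * ?k b) = (\<Sum>b\<in>Basis. ?D f a b * w (?u b))"
      using tangent_sum[OF A w, of Basis "\<lambda>b. ?u b * ?k b"]
      by (simp add: smooth_fun_mult[OF A] u k tangent_mult[OF A w] Ep G(2))
    moreover have "X p f = (\<Sum>b\<in>Basis. w (?u b) * ?D f a b)"
    proof -
      have l: "linear (?D f a)" using D[OF f U(2)] by (simp add: a_def has_derivative_linear)
      show ?thesis
        unfolding X_def using f
        by (simp add: Ep c_def linear_sum[OF l] linear_scale[OF l])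
    qed
    ultimately show ?thesis unfolding decomp by (simp add: mult.commute)
  qed
  ultimately show ?thesis using that by blast
qed


section \<open>Connections on almost Norden manifolds\<close>

lemma tangent_space_add:
  assumes "v \<in> tangent_space A p" "w \<in> tangent_space A p"
  shows "v + w \<in> tangent_space A p"
  using assms unfolding tangent_space_def by (auto simp: algebra_simps)

lemma tangent_space_scl:
  assumes "v \<in> tangent_space A p"
  shows "scl c v \<in> tangent_space A p"
  using assms unfolding tangent_space_def by (auto simp: scl_def algebra_simps)

lemma vector_fields_tangent: "X \<in> vector_fields A \<Longrightarrow> X p \<in> tangent_space A p"
  unfolding vector_fields_def by blast

text \<open>Paired with Z, the difference of the connections is symmetric in X, Y by
  torsion-freeness and antisymmetric in Y, Z by metric compatibility, here phrased as
  self-conjugacy. It therefore vanishes against all fields Z, and nondegeneracy applies.\<close>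

lemma torsion_free_metric_connection_unique:
  assumes A: "smooth_manifold A" and h: "pseudo_riemannian_metric A h"
    and D: "linear_connection A D" "torsion_free A D" "conjugate_rel_metric A h D D"
    and D': "linear_connection A D'" "torsion_free A D'" "conjugate_rel_metric A h D' D'"
    and XY: "X \<in> vector_fields A" "Y \<in> vector_fields A"
  shows "D X Y = D' X Y"
proof
  fix p
  note T = vector_fields_tangent[of _ A p]
  have DV: "D X Y \<in> vector_fields A" "D' X Y \<in> vector_fields A"
    if "X \<in> vector_fields A" "Y \<in> vector_fields A" for X Y
    using D(1) D'(1) that unfolding linear_connection_def by auto
  have sym: "h p v w = h p w v" if "v \<in> tangent_space A p" "w \<in> tangent_space A p" for v w
    using h that unfolding pseudo_riemannian_metric_def by blast
  have add: "h p (u + v) w = h p u w + h p v w"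
    and scl: "h p (scl c v) w = c * h p v w"
    if "u \<in> tangent_space A p" "v \<in> tangent_space A p" "w \<in> tangent_space A p" for u v w c
    using h that unfolding pseudo_riemannian_metric_def smooth_form2_def by simp_all
  define a where "a X Y Z = h p (D X Y p) (Z p) - h p (D' X Y p) (Z p)" for X Y Z
  have a1: "a X Y Z = a Y X Z"
    if "X \<in> vector_fields A" "Y \<in> vector_fields A" "Z \<in> vector_fields A" for X Y Z
  proof -
    have "torsion D X Y = 0" "torsion D' X Y = 0"
      using D(2) D'(2) that unfolding torsion_free_def by auto
    then have "D X Y - D Y X = D' X Y - D' Y X" by (simp add: torsion_def)
    then have "D X Y + D' Y X = D' X Y + D Y X" by (simp only: diff_eq_eq) (simp add: algebra_simps)
    then have "D X Y p + D' Y X p = D' X Y p + D Y X p" by (metis plus_fun_apply)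
    then have "h p (D X Y p + D' Y X p) (Z p) = h p (D' X Y p + D Y X p) (Z p)" by (rule arg_cong)
    then show ?thesis by (simp add: add T DV that a_def)
  qed
  have a2: "a X Y Z = - a X Z Y"
    if "X \<in> vector_fields A" "Y \<in> vector_fields A" "Z \<in> vector_fields A" for X Y Z
  proof -
    have "eval2 h (D X Y) Z p + eval2 h Y (D X Z) p = eval2 h (D' X Y) Z p + eval2 h Y (D' X Z) p"
      using D(3) D'(3) that unfolding conjugate_rel_metric_def by metis
    then show ?thesis
      using sym[OF T T, of Y "D X Z"] sym[OF T T, of Y "D' X Z"] that DV
      by (simp add: eval2_def a_def)
  qed
  \<comment> \<open>A trilinear form symmetric in its first two and antisymmetric in its last two arguments is zero.\<close>
  have a0: "a X Y Z = 0" if "Z \<in> vector_fields A" for Z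
    using a1[OF XY that] a2[OF XY that] a1[OF XY(1) that XY(2)] a2[OF that XY]
      a1[OF that XY(2,1)] a2[OF XY(2) that XY(1)] by linarith
  \<comment> \<open>The difference is written with \<open>scl (- 1)\<close> because linearity of h
    is given for sums and \<open>scl\<close>.\<close>
  let ?v = "D X Y p + scl (- 1) (D' X Y p)"
  note t = T[OF DV(1)[OF XY]] T[OF DV(2)[OF XY]]
  have v: "?v \<in> tangent_space A p"
    by (intro tangent_space_add tangent_space_scl t)
  have "h p ?v w = 0" if w: "w \<in> tangent_space A p" for w
  proof -
    obtain Z where Z: "Z \<in> vector_fields A" "Z p = w"
      using tangent_vector_extension[OF A w] .
    show ?thesis
      using a0[OF Z(1)] by (simp only: a_def Z(2) add[OF t(1) tangent_space_scl[OF t(2)] w] scl[OF t(2,2) w])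
  qed
  then have "?v = 0"
    using h v unfolding pseudo_riemannian_metric_def by blast
  then show "D X Y p = D' X Y p" by (simp add: scl_minus_one)
qed

text \<open>Additivity suffices, through \<open>D X 0 = 0\<close>. This carries the sign of J^2 =
  -id through a connection.\<close>

lemma linear_connection_minus:
  assumes A: "smooth_manifold A" and D: "linear_connection A D"
    and V: "X \<in> vector_fields A" "Y \<in> vector_fields A" "- Y \<in> vector_fields A"
  shows "D X (- Y) = - D X Y"
proof -
  have 0: "0 \<in> vector_fields A"
    using smooth_fun_const[OF A, of 0] by (simp add: vector_fields_def tangent_space_def)
  have add: "D X (Y + Z) = D X Y + D X Z" if "Y \<in> vector_fields A" "Z \<in> vector_fields A" for Y Z
    using D V(1) that unfolding linear_connection_def by blast
  have "D X 0 = 0" using add[OF 0 0] by simp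
  then show ?thesis using add[OF V(2,3)] by (simp add: eq_neg_iff_add_eq_0 add.commute)
qed

section \<open>Interplay of J, the metric and the connections\<close>

context
  fixes A :: "('a::{t2_space,second_countable_topology}, 'e::euclidean_space) atlas"
    and J :: "'a endo" and h :: "'a form2"
  assumes N: "almost_norden_manifold A J h"
begin

lemma almost_norden_app: "X \<in> vector_fields A \<Longrightarrow> app J X \<in> vector_fields A"
  using N unfolding almost_norden_manifold_def almost_complex_structure_def smooth_endo_def by blast

lemma almost_norden_app_app: "X \<in> vector_fields A \<Longrightarrow> app J (app J X) = - X"
  using N vector_fields_tangent[of X A]
  unfolding almost_norden_manifold_def almost_complex_structure_def by (auto simp: app_def fun_eq_iff)

text \<open>Both sides are J^3 X.\<close>

lemma almost_norden_app_minus: "X \<in> vector_fields A \<Longrightarrow> app J (- X) = - app J X"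
  by (metis almost_norden_app almost_norden_app_app)

text \<open>Self-adjointness of J comes from combining the symmetry of the associated metric with
  that of h.\<close>

lemma almost_norden_eval2_app:
  assumes "X \<in> vector_fields A" "Y \<in> vector_fields A"
  shows "eval2 h (app J X) Y = eval2 h X (app J Y)"
proof
  fix p
  note t = assms[THEN vector_fields_tangent, of p] almost_norden_app[OF assms(1), THEN vector_fields_tangent, of p]
  have "h p (X p) (J p (Y p)) = h p (Y p) (J p (X p))"
    using associated_metric_pseudo_riemannian[OF N] t
    unfolding pseudo_riemannian_metric_def associated_metric_def by blast
  also have "\<dots> = h p (J p (X p)) (Y p)"
    using N t unfolding almost_norden_manifold_def pseudo_riemannian_metric_def app_def by metis
  finally show "eval2 h (app J X) Y p = eval2 h X (app J Y) p"
    by (simp add: eval2_def app_def)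
qed

lemma eval2_associated_metric: "eval2 (associated_metric J h) X Y = eval2 h X (app J Y)"
  by (simp add: eval2_def associated_metric_def app_def)

text \<open>Allows the results about h to be applied to the associated metric as well; the
  anti-isometry of J is that of h with J w in place of w.\<close>

lemma almost_norden_associated: "almost_norden_manifold A J (associated_metric J h)"
proof -
  have "associated_metric J h p (J p v) (J p w) = - associated_metric J h p v w"
    if "v \<in> tangent_space A p" "w \<in> tangent_space A p" for p v w
    using N that
    unfolding almost_norden_manifold_def almost_complex_structure_def smooth_endo_def associated_metric_def
    by blast
  then show ?thesis
    using N associated_metric_pseudo_riemannian[OF N] unfolding almost_norden_manifold_def by simp
qed

lemma statistical_conjugate_parallel:
  assumes S: "statistical_manifold A h D D'" and E: "conjugate_rel_endo A J D D'"
  shows "levi_civita_connection A h D"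
    and "\<And>X Y. X \<in> vector_fields A \<Longrightarrow> Y \<in> vector_fields A \<Longrightarrow> D X (app J Y) = app J (D X Y)"
proof -
  let ?k = "associated_metric J h"
  note V = almost_norden_app
  have A: "smooth_manifold A" and L: "linear_connection A D" "linear_connection A D'"
    and T: "torsion_free A D" "torsion_free A D'" and C: "conjugate_rel_metric A h D D'"
    using S unfolding statistical_manifold_def by auto
  have DV: "D X Y \<in> vector_fields A" "D' X Y \<in> vector_fields A"
    if "X \<in> vector_fields A" "Y \<in> vector_fields A" for X Y
    using L that unfolding linear_connection_def by auto
  have D': "D' X Y = - app J (D X (app J Y))"
    if "X \<in> vector_fields A" "Y \<in> vector_fields A" for X Y
    using E that unfolding conjugate_rel_endo_def by blast
  \<comment> \<open>From D' = -J D J: precomposing with J gives D' J = -J D J^2 = J D, and composing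
    with J on the left gives J D' = -J^2 D J = D J.\<close>
  have D'J: "D' X (app J Y) = app J (D X Y)" and DJ: "D X (app J Y) = app J (D' X Y)"
    if X: "X \<in> vector_fields A" and Y: "Y \<in> vector_fields A" for X Y
  proof -
    have "- Y \<in> vector_fields A" using V[OF V[OF Y]] almost_norden_app_app[OF Y] by simp
    from linear_connection_minus[OF A L(1) X Y this]
    show "D' X (app J Y) = app J (D X Y)"
      using D'[OF X V[OF Y]] almost_norden_app_app[OF Y] almost_norden_app_minus[OF DV(1)[OF X Y]] by simp
    show "D X (app J Y) = app J (D' X Y)"
      unfolding D'[OF X Y]
      using almost_norden_app_app[OF DV(1)[OF X V[OF Y]]] almost_norden_app_minus[OF V[OF DV(1)[OF X V[OF Y]]]]
      by simp
  qed
  have kD: "conjugate_rel_metric A ?k D D"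
    unfolding conjugate_rel_metric_def eval2_associated_metric
    using C V D'J unfolding conjugate_rel_metric_def by metis
  have kD': "conjugate_rel_metric A ?k D' D'"
    unfolding conjugate_rel_metric_def eval2_associated_metric
  proof (intro ballI allI)
    fix X Y Z p assume v: "X \<in> vector_fields A" "Y \<in> vector_fields A" "Z \<in> vector_fields A"
    \<comment> \<open>Here J Y enters the first slot; \<open>DJ\<close> turns D J into J D', and
      self-adjointness then moves every J to the second argument, giving the associated
      metric.\<close>
    have "X p (eval2 h (app J Y) Z) = eval2 h (D X (app J Y)) Z p + eval2 h (app J Y) (D' X Z) p"
      using C V v unfolding conjugate_rel_metric_def by blast
    then show "X p (eval2 h Y (app J Z)) = eval2 h (D' X Y) (app J Z) p + eval2 h Y (app J (D' X Z)) p"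
      by (simp add: DJ almost_norden_eval2_app v DV)
  qed
  have eq: "D X Y = D' X Y" if "X \<in> vector_fields A" "Y \<in> vector_fields A" for X Y
    by (rule torsion_free_metric_connection_unique[OF A associated_metric_pseudo_riemannian[OF N]
          L(1) T(1) kD L(2) T(2) kD' that])
  then show "D X (app J Y) = app J (D X Y)" if "X \<in> vector_fields A" "Y \<in> vector_fields A" for X Y
    using D'J that V by metis
  show "levi_civita_connection A h D"
    using L(1) T(1) C eq unfolding levi_civita_connection_def conjugate_rel_metric_def by metis
qed

lemma kahler_nordenI:
  assumes "levi_civita_connection A h D"
    and "\<And>X Y. X \<in> vector_fields A \<Longrightarrow> Y \<in> vector_fields A \<Longrightarrow> D X (app J Y) = app J (D X Y)"
  shows "kahler_norden_manifold A J h"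
  using N assms unfolding kahler_norden_manifold_def cov_deriv_endo_def by auto

text \<open>Since J^4 = id, the associated metric at (Y, J^3 Z) is h(Y, Z). Evaluate its
  compatibility at J^3 Z and pull the three factors J out of D. Using J^3 for the inverse of J
  avoids signs.\<close>

lemma levi_civita_associated_metric:
  assumes L: "levi_civita_connection A (associated_metric J h) D"
    and DJ: "\<And>X Y. X \<in> vector_fields A \<Longrightarrow> Y \<in> vector_fields A \<Longrightarrow> D X (app J Y) = app J (D X Y)"
  shows "levi_civita_connection A h D"
  unfolding levi_civita_connection_def
proof (intro conjI ballI allI)
  show D: "linear_connection A D" "torsion_free A D"
    using L unfolding levi_civita_connection_def by auto
  note V = almost_norden_app
  have J4: "eval2 (associated_metric J h) Y (app J (app J (app J Z))) = eval2 h Y Z"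
    if "Z \<in> vector_fields A" for Y Z
    using almost_norden_app_app[OF V[OF V[OF that]]] almost_norden_app_app[OF that]
    by (simp add: eval2_associated_metric)
  fix X Y Z p assume v: "X \<in> vector_fields A" "Y \<in> vector_fields A" "Z \<in> vector_fields A"
  have DZ: "D X Z \<in> vector_fields A"
    using D(1) v unfolding linear_connection_def by blast
  let ?W = "app J (app J (app J Z))"
  have "X p (eval2 (associated_metric J h) Y ?W) = eval2 (associated_metric J h) (D X Y) ?W p +
      eval2 (associated_metric J h) Y (D X ?W) p"
    using L v V unfolding levi_civita_connection_def by blast
  then show "X p (eval2 h Y Z) = eval2 h (D X Y) Z p + eval2 h Y (D X Z) p"
    by (simp add: DJ v V J4 DZ)
qed

end

theorem corollary2p3:
  fixes A :: "('a::{t2_space,second_countable_topology}, 'e::euclidean_space) atlas"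
    and J :: "'a endo" and g :: "'a form2"
    and D D' :: "'a vfield \<Rightarrow> 'a vfield \<Rightarrow> 'a vfield"
  assumes "almost_norden_manifold A J g"
    and "linear_connection A D" and "linear_connection A D'"
  shows "(statistical_manifold A g D D' \<and> conjugate_rel_endo A J D D'
            \<longrightarrow> kahler_norden_manifold A J g) \<and>
         (statistical_manifold A (associated_metric J g) D D' \<and> conjugate_rel_endo A J D D'
            \<longrightarrow> kahler_norden_manifold A J g)"
proof (intro conjI impI; elim conjE)
  note N = assms(1) and N' = almost_norden_associated[OF assms(1)]
  assume E: "conjugate_rel_endo A J D D'"
  {
    assume "statistical_manifold A g D D'"
    note P = statistical_conjugate_parallel[OF N this E]
    show "kahler_norden_manifold A J g"
      by (rule kahler_nordenI[OF N, of D]) (use P in auto)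
  next
    assume "statistical_manifold A (associated_metric J g) D D'"
    \<comment> \<open>With the associated metric in the role of h, D is the Levi-Civita connection
      of that metric and J is parallel, which is what the passage back to g requires.\<close>
    note P = statistical_conjugate_parallel[OF N' this E]
    show "kahler_norden_manifold A J g"
      by (rule kahler_nordenI[OF N, of D]) (use P in \<open>auto intro: levi_civita_associated_metric[OF N, of D]\<close>)
  }
qed

end
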